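(* Let $G$ be an unweighted undirected graph, let $f\ge 1$ be an integer, let $A$ be a $\beta$-additive spanner of $G$, and let $M$ be an $\alpha$-multiplicative $f$-EFT spanner of $G$. Then the graph $H=(V(G),E(A)\cup E(M))$ is a $\bigl(2f(\beta+\alpha-1)+\beta\bigr)$-additive $f$-EFT spanner of $G$. Moreover, in the special case $f=1$, $H$ is a $(2\beta+\alpha-1)$-additive EFT spanner of $G$.
   Context: All graphs are unweighted and undirected; $d_X(u,v)$ denotes the shortest-path distance between $u$ and $v$ in graph $X$ (equal to $\infty$ if they are disconnected). For $F\subseteq E(G)$, $X-F$ is the graph obtained by removing the edges of $F$. A $\beta$-additive spanner of $G$ is a spanning subgraph $A$ with $d_A(s,t)\le d_G(s,t)+\beta$ for all $s,t\in V(G)$. An $\alpha$-multiplicative $f$-EFT (edge fault-tolerant) spanner of $G$ is a subgraph $M$ such that for every $F\subseteq E(G)$ with $|F|\le f$ and all $s,t\in V(G)$, $d_{M-F}(s,t)\le \alpha\, d_{G-F}(s,t)$. A $\gamma$-additive $f$-EFT spanner is a subgraph $H$ such that for every $F\subseteq E(G)$ with $|F|\le f$ and all $s,t$, $d_{H-F}(s,t)\le d_{G-F}(s,t)+\gamma$; if $d_{G-F}(s,t)=\infty$ the inequality is considered trivially satisfied. "EFT" means 1-EFT. *)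

theory Defs
  imports Main "HOL-Library.Extended_Real"
begin

definition graph :: "'a set \<Rightarrow> 'a set set \<Rightarrow> bool" where
  "graph V E \<longleftrightarrow> finite V \<and> (\<forall>e\<in>E. e \<subseteq> V \<and> card e = 2)"

definition walk :: "'a set \<Rightarrow> 'a set set \<Rightarrow> 'a list \<Rightarrow> bool" where
  "walk V X p \<longleftrightarrow> p \<noteq> [] \<and> set p \<subseteq> V \<and>
     (\<forall>i. Suc i < length p \<longrightarrow> {p ! i, p ! Suc i} \<in> X)"

text \<open>Shortest-path distance (number of edges), \<infinity> if disconnected.\<close>
definition gdist :: "'a set \<Rightarrow> 'a set set \<Rightarrow> 'a \<Rightarrow> 'a \<Rightarrow> enat" where
  "gdist V X s t = (INF p \<in> {p. walk V X p \<and> hd p = s \<and> last p = t}. enat (length p - 1))"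

definition additive_spanner :: "'a set \<Rightarrow> 'a set set \<Rightarrow> 'a set set \<Rightarrow> real \<Rightarrow> bool" where
  "additive_spanner V E EA \<beta> \<longleftrightarrow> EA \<subseteq> E \<and>
     (\<forall>s\<in>V. \<forall>t\<in>V. ereal_of_enat (gdist V EA s t) \<le> ereal_of_enat (gdist V E s t) + ereal \<beta>)"

definition mult_ft_spanner :: "'a set \<Rightarrow> 'a set set \<Rightarrow> 'a set set \<Rightarrow> real \<Rightarrow> nat \<Rightarrow> bool" where
  "mult_ft_spanner V E EM \<alpha> f \<longleftrightarrow> EM \<subseteq> E \<and>
     (\<forall>F. F \<subseteq> E \<and> card F \<le> f \<longrightarrow> (\<forall>s\<in>V. \<forall>t\<in>V.
        ereal_of_enat (gdist V (EM - F) s t) \<le> ereal \<alpha> * ereal_of_enat (gdist V (E - F) s t)))"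

text \<open>(V, EH) is a gamma-additive f-EFT spanner of (V, E); when the G-F distance is
  infinite the inequality holds trivially (the right-hand side is \<infinity>).\<close>
definition additive_ft_spanner :: "'a set \<Rightarrow> 'a set set \<Rightarrow> 'a set set \<Rightarrow> real \<Rightarrow> nat \<Rightarrow> bool" where
  "additive_ft_spanner V E EH \<gamma> f \<longleftrightarrow> EH \<subseteq> E \<and>
     (\<forall>F. F \<subseteq> E \<and> card F \<le> f \<longrightarrow> (\<forall>s\<in>V. \<forall>t\<in>V.
        ereal_of_enat (gdist V (EH - F) s t) \<le> ereal_of_enat (gdist V (E - F) s t) + ereal \<gamma>))"

end

theory Submission
  imports Defs
begin

text \<open>Colour every vertex by an endpoint of a failed edge that is nearest to it in \<open>A\<close>. If two
  vertices \<open>x\<close>, \<open>y\<close> share the colour \<open>u\<close>, no shortest \<open>x\<close>-\<open>y\<close> path of \<open>A\<close> contains a failed edge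
  \<open>{a, b}\<close>: the detour through \<open>u\<close>, which is at least as close to \<open>x\<close> as \<open>a\<close> and to \<open>y\<close> as \<open>b\<close>,
  would be shorter by 1. So along a shortest path of \<open>G - F\<close> one jumps inside \<open>A - F\<close> to the last
  vertex of the current colour, crosses the next edge inside \<open>M - F\<close>, and never meets that colour
  again. There are at most \<open>2f\<close> colours, hence at most \<open>2f\<close> jumps, each with surplus \<open>\<beta>\<close>, and
  \<open>2f - 1\<close> crossings, each with surplus \<open>\<alpha> - 1\<close>. For \<open>f = 1\<close> this is exactly the sharper bound.\<close>

section \<open>Walks and shortest-path distance\<close>

lemma walk_mono: "walk V X p \<Longrightarrow> X \<subseteq> Y \<Longrightarrow> walk V Y p"
  unfolding walk_def by blast

lemma walk_rev: "walk V X p \<Longrightarrow> walk V X (rev p)"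
  unfolding walk_def
proof (elim conjE, intro conjI allI impI, simp_all)
  fix i assume *: "\<forall>i. Suc i < length p \<longrightarrow> {p ! i, p ! Suc i} \<in> X" and i: "Suc i < length p"
  let ?j = "length p - Suc (Suc i)"
  have "{p ! ?j, p ! Suc ?j} \<in> X"
    using * i by simp
  moreover have "rev p ! i = p ! Suc ?j" "rev p ! Suc i = p ! ?j"
    using i by (simp_all add: rev_nth Suc_diff_Suc)
  ultimately show "{rev p ! i, rev p ! Suc i} \<in> X"
    by (simp add: insert_commute)
qed

lemma walk_append:
  assumes p: "walk V X p" and q: "walk V X q" and pq: "last p = hd q"
  shows "walk V X (p @ tl q)"
proof -
  obtain a r where q_eq: "q = a # r"
    using q by (cases q) (auto simp: walk_def)
  \<comment> \<open>The shift already applies at the last position of \<open>p\<close>, since the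
    vertex there is also the first one of \<open>q\<close>. This covers the step that crosses the
    seam.\<close>
  have nth: "(p @ r) ! i = q ! (i - (length p - 1))" if "i \<ge> length p - 1" for i
    using that p pq q_eq
    by (cases "i = length p - 1") (auto simp: walk_def nth_append last_conv_nth nth_Cons')
  have "{(p @ r) ! i, (p @ r) ! Suc i} \<in> X" if i: "Suc i < length (p @ r)" for i
  proof (cases "Suc i < length p")
    case True
    then show ?thesis using p by (simp add: walk_def nth_append)
  next
    case False
    define j where "j = i - (length p - 1)"
    have "(p @ r) ! i = q ! j" "(p @ r) ! Suc i = q ! Suc j"
      using False nth[of i] nth[of "Suc i"] by (auto simp: j_def Suc_diff_le)
    moreover have "Suc j < length q"
      using False i p by (auto simp: j_def q_eq walk_def)
    ultimately show ?thesis using q by (simp add: walk_def)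
  qed
  then show ?thesis
    using p q by (auto simp: walk_def q_eq)
qed

lemma walk_infix:
  assumes "walk V X p" and "i \<le> j" and "j < length p"
  shows "walk V X (take (Suc (j - i)) (drop i p))"
  using assms set_take_subset[of "Suc (j - i)" "drop i p"] set_drop_subset[of i p]
  by (auto simp: walk_def)

lemma gdist_le_walk: "walk V X p \<Longrightarrow> gdist V X (hd p) (last p) \<le> enat (length p - 1)"
  unfolding gdist_def by (rule INF_lower) simp

lemma gdist_le_walk_infix:
  assumes "walk V X p" and "i \<le> j" and "j < length p"
  shows "gdist V X (p ! i) (p ! j) \<le> enat (j - i)"
  using gdist_le_walk[OF walk_infix[OF assms]] assms
  by (simp add: hd_drop_conv_nth last_conv_nth)

text \<open>The empty set has infimum infinity in \<open>enat\<close>, so a finite distance means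
  that some walk exists, and by well-ordering the infimum is attained.\<close>

lemma gdist_shortest_walkE:
  assumes "gdist V X s t = enat n"
  obtains p where "walk V X p" "hd p = s" "last p = t" "length p = Suc n"
proof -
  let ?S = "(\<lambda>p. enat (length p - 1)) ` {p. walk V X p \<and> hd p = s \<and> last p = t}"
  have Inf: "Inf ?S = enat n"
    using assms by (simp add: gdist_def)
  then have "?S \<noteq> {}"
    by (metis Inf_enat_def enat.distinct(1))
  then have "Inf ?S \<in> ?S"
    unfolding Inf_enat_def by (simp only: if_False) (meson LeastI_ex ex_in_conv)
  then have "enat n \<in> ?S"
    unfolding Inf .
  then obtain p where "walk V X p" "hd p = s" "last p = t" "length p - 1 = n"
    by auto
  then show thesis
    using that[of p] by (cases p) (auto simp: walk_def)
qed

lemma gdist_antimono: "X \<subseteq> Y \<Longrightarrow> gdist V Y s t \<le> gdist V X s t"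
  unfolding gdist_def by (rule INF_superset_mono) (auto intro: walk_mono)

lemma gdist_commute: "gdist V X s t = gdist V X t s"
proof -
  have "gdist V X t s \<le> gdist V X s t" for s t
  proof (cases "gdist V X s t")
    case (enat n)
    then obtain p where "walk V X p" "hd p = s" "last p = t" "length p = Suc n"
      by (rule gdist_shortest_walkE)
    then show ?thesis
      using gdist_le_walk[OF walk_rev, of V X p] enat by (simp add: hd_rev last_rev)
  qed simp
  then show ?thesis by (simp add: antisym)
qed

lemma gdist_triangle: "gdist V X s u \<le> gdist V X s t + gdist V X t u"
proof (cases "gdist V X s t"; cases "gdist V X t u")
  fix m n assume m: "gdist V X s t = enat m" and n: "gdist V X t u = enat n"
  obtain p where p: "walk V X p" "hd p = s" "last p = t" "length p = Suc m"
    using m by (rule gdist_shortest_walkE)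
  obtain q where q: "walk V X q" "hd q = t" "last q = u" "length q = Suc n"
    using n by (rule gdist_shortest_walkE)
  have "hd (p @ tl q) = s"
    using p by (auto simp: walk_def)
  moreover have "last (p @ tl q) = u"
    using p q by (cases q) (auto simp: walk_def)
  ultimately show ?thesis
    using gdist_le_walk[OF walk_append[OF p(1) q(1)]] p q m n by simp
qed auto

section \<open>Failed edges and colours\<close>

lemma gdist_remove_edges_eq:
  assumes near: "\<And>w. w \<in> \<Union>F \<Longrightarrow> gdist V X x u \<le> gdist V X x w"
    "\<And>w. w \<in> \<Union>F \<Longrightarrow> gdist V X y u \<le> gdist V X y w"
  shows "gdist V (X - F) x y = gdist V X x y"
proof (cases "gdist V X x y")
  case (enat n)
  then obtain p where p: "walk V X p" "hd p = x" "last p = y" "length p = Suc n"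
    by (rule gdist_shortest_walkE)
  have xy: "p ! 0 = x" "p ! n = y"
    using p by (auto simp: walk_def hd_conv_nth last_conv_nth)
  have "{p ! i, p ! Suc i} \<notin> F" if i: "Suc i < length p" for i
  proof
    assume "{p ! i, p ! Suc i} \<in> F"
    then have fault: "p ! i \<in> \<Union>F" "p ! Suc i \<in> \<Union>F" by auto
    \<comment> \<open>The two halves of the detour through \<open>u\<close> cost no more than the
      walk before and after the failed edge; that edge itself is saved, leaving at most
      \<open>n - 1\<close>.\<close>
    have "gdist V X x u \<le> enat i"
      using near(1)[OF fault(1)] gdist_le_walk_infix[OF p(1), of 0 i] i xy by force
    moreover have "gdist V X u y \<le> enat (n - Suc i)"
      using near(2)[OF fault(2)] gdist_le_walk_infix[OF p(1), of "Suc i" n] i xy p(4)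
      by (simp add: gdist_commute[of V X y])
    ultimately have "gdist V X x y \<le> enat i + enat (n - Suc i)"
      using gdist_triangle[of V X x y u] add_mono order_trans by blast
    then show False
      using enat i p(4) by simp
  qed
  then have "walk V (X - F) p"
    using p(1) by (auto simp: walk_def)
  then have "gdist V (X - F) x y \<le> gdist V X x y"
    using gdist_le_walk[of V "X - F" p] p enat by simp
  then show ?thesis
    using gdist_antimono[of "X - F" X V x y] by auto
next
  case infinity
  then show ?thesis
    using gdist_antimono[of "X - F" X V x y] by auto
qed

lemma fault_colouring:
  assumes edges: "\<And>e. e \<in> F \<Longrightarrow> card e = 2" and "finite F" and "card F \<le> f" and "f \<ge> 1"
  obtains c :: "'a \<Rightarrow> 'a" where "finite (range c)" "card (range c) \<le> 2 * f"
    "\<And>x y. c x = c y \<Longrightarrow> gdist V (X - F) x y = gdist V X x y"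
proof (cases "F = {}")
  case True
  \<comment> \<open>Without failed edges there is no endpoint to choose. A constant colouring uses
    one colour, which is at most \<open>2 * f\<close>.\<close>
  then show thesis
    using that[of "\<lambda>_. undefined"] \<open>f \<ge> 1\<close> by simp
next
  case False
  have fin: "finite (\<Union>F)"
    using \<open>finite F\<close> edges by (metis card.infinite finite_Union zero_neq_numeral)
  obtain e where "e \<in> F" using False by blast
  with edges[of e] have ne: "\<Union>F \<noteq> {}"
    by fastforce
  \<comment> \<open>The minimum is taken in \<open>enat\<close> and may be infinite, so a vertex
    that reaches no failed edge gets a colour too.\<close>
  have "\<exists>u\<in>\<Union>F. \<forall>w\<in>\<Union>F. gdist V X x u \<le> gdist V X x w" for x
    using fin ne by (meson arg_min_if_finite(1) arg_min_least)
  then obtain c where c: "\<And>x. c x \<in> \<Union>F"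
    "\<And>x w. w \<in> \<Union>F \<Longrightarrow> gdist V X x (c x) \<le> gdist V X x w"
    by metis
  have "card (\<Union>F) \<le> (\<Sum>e\<in>F. card e)"
    by (rule card_Union_le_sum_card)
  also have "\<dots> = 2 * card F"
    using edges by simp
  finally have "card (\<Union>F) \<le> 2 * f"
    using \<open>card F \<le> f\<close> by linarith
  moreover have "range c \<subseteq> \<Union>F"
    using c(1) by blast
  ultimately show thesis
    using that[of c] fin c(2) card_mono[OF fin] gdist_remove_edges_eq[of F V X]
    by (metis finite_subset order_trans)
qed

text \<open>\<open>D i j\<close> stands for the distance between positions \<open>i\<close> and
  \<open>j\<close> of a path. With \<open>m\<close> colours on \<open>{i..k}\<close> there are at
  most \<open>m\<close> jumps and \<open>m - 1\<close> crossings, and m \<beta> + (m - 1) (\<alpha>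
  - 1) regroups to (m - 1) (\<beta> + \<alpha> - 1) + \<beta>.\<close>

lemma coloured_chain_bound:
  fixes D :: "nat \<Rightarrow> nat \<Rightarrow> ereal" and c :: "nat \<Rightarrow> 'c" and \<alpha> \<beta> :: real
  assumes triangle: "\<And>i j l. D i l \<le> D i j + D j l"
    and step: "\<And>i. i < k \<Longrightarrow> D i (Suc i) \<le> ereal \<alpha>"
    and jump: "\<And>i j. \<lbrakk>i \<le> j; j \<le> k; c i = c j\<rbrakk> \<Longrightarrow> D i j \<le> ereal (real (j - i) + \<beta>)"
    and nonneg: "\<beta> + \<alpha> - 1 \<ge> 0"
    and "i \<le> k"
  shows "D i k \<le> ereal (real (k - i) + (real (card (c ` {i..k})) - 1) * (\<beta> + \<alpha> - 1) + \<beta>)"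
  using \<open>i \<le> k\<close>
proof (induction "k - i" arbitrary: i rule: less_induct)
  case less
  define j where "j = Max {j \<in> {i..k}. c j = c i}"
  have "j \<in> {j \<in> {i..k}. c j = c i}"
    unfolding j_def using less.prems by (intro Max_in) auto
  then have j: "i \<le> j" "j \<le> k" "c j = c i" by auto
  have j_last: "c l \<noteq> c i" if "j < l" "l \<le> k" for l
  proof
    assume "c l = c i"
    then have "l \<le> j"
      unfolding j_def using that j(1) by (intro Max_ge) auto
    with that show False by simp
  qed
  have Dij: "D i j \<le> ereal (real (j - i) + \<beta>)"
    using jump j by simp
  show ?case
  proof (cases "j = k")
    case True
    \<comment> \<open>A single jump reaches the end; the colour \<open>c i\<close> keeps the factor
      of the remaining surplus nonnegative.\<close>
    have "card (c ` {i..k}) \<ge> 1"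
      using less.prems by (simp add: Suc_le_eq card_gt_0_iff)
    then have "0 \<le> (real (card (c ` {i..k})) - 1) * (\<beta> + \<alpha> - 1)"
      using nonneg by simp
    then have "ereal (real (j - i) + \<beta>)
        \<le> ereal (real (k - i) + (real (card (c ` {i..k})) - 1) * (\<beta> + \<alpha> - 1) + \<beta>)"
      using True by simp
    with Dij show ?thesis
      unfolding True by (rule order_trans)
  next
    case False
    then have jk: "Suc j \<le> k" using j by simp
    let ?m = "card (c ` {Suc j..k})"
    have "insert (c i) (c ` {Suc j..k}) \<subseteq> c ` {i..k}"
      using j jk less.prems by auto
    moreover have "c i \<notin> c ` {Suc j..k}"
      using j_last by (metis atLeastAtMost_iff imageE Suc_le_eq)
    \<comment> \<open>The lost colour \<open>c i\<close> pays for this round: one jump and one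
      crossing.\<close>
    ultimately have card: "Suc ?m \<le> card (c ` {i..k})"
      by (metis card_insert_disjoint card_mono finite_atLeastAtMost finite_imageI)
    have "D i k \<le> D i j + (D j (Suc j) + D (Suc j) k)"
      by (meson add_left_mono order_trans triangle)
    also have "\<dots> \<le> ereal (real (j - i) + \<beta>) +
        (ereal \<alpha> + ereal (real (k - Suc j) + (real ?m - 1) * (\<beta> + \<alpha> - 1) + \<beta>))"
      using Dij step[of j] jk j less.hyps[of "Suc j"] by (intro add_mono) auto
    also have "\<dots> = ereal (real (k - i) + real ?m * (\<beta> + \<alpha> - 1) + \<beta>)"
      using j jk by (simp add: of_nat_diff algebra_simps)
    also have "\<dots> \<le> ereal (real (k - i) + (real (card (c ` {i..k})) - 1) * (\<beta> + \<alpha> - 1) + \<beta>)"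
      using card nonneg by (auto intro!: mult_right_mono)
    finally show ?thesis .
  qed
qed

section \<open>The union of the two spanners\<close>

lemma additive_spanner_nonneg:
  assumes "additive_spanner V E EA \<beta>" and "s \<in> V"
  shows "\<beta> \<ge> 0"
proof -
  have "walk V E [s]"
    using assms(2) by (simp add: walk_def)
  then have "gdist V E s s = 0"
    using gdist_le_walk[of V E "[s]"] by (simp add: zero_enat_def[symmetric])
  then have "ereal_of_enat (gdist V EA s s) \<le> ereal \<beta>"
    using assms by (fastforce simp: additive_spanner_def)
  then have "0 \<le> ereal \<beta>"
    by (rule order_trans[rotated]) (simp add: ereal_of_enat_nonneg)
  then show ?thesis by simp
qed

text \<open>The general \<gamma> serves both bounds of the theorem. Its condition is guarded by
  \<beta> \<ge> 0 because that sign is derived from a vertex; for empty \<open>V\<close> the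
  distance bounds are vacuous.\<close>

lemma additive_ft_spanner_union:
  fixes \<alpha> \<beta> \<gamma> :: real
  assumes G: "graph V E" and f: "f \<ge> 1" and \<alpha>: "\<alpha> \<ge> 1"
    and A: "additive_spanner V E EA \<beta>" and M: "mult_ft_spanner V E EM \<alpha> f"
    and \<gamma>: "\<beta> \<ge> 0 \<Longrightarrow> (2 * real f - 1) * (\<beta> + \<alpha> - 1) + \<beta> \<le> \<gamma>"
  shows "additive_ft_spanner V E (EA \<union> EM) \<gamma> f"
  unfolding additive_ft_spanner_def
proof (intro conjI allI impI ballI)
  show "EA \<union> EM \<subseteq> E"
    using A M by (auto simp: additive_spanner_def mult_ft_spanner_def)
next
  fix F s t assume F: "F \<subseteq> E \<and> card F \<le> f" and st: "s \<in> V" "t \<in> V"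
  let ?H = "EA \<union> EM - F"
  have \<beta>: "\<beta> \<ge> 0"
    using additive_spanner_nonneg[OF A st(1)] .
  \<comment> \<open>Finiteness of \<open>F\<close> comes from that of \<open>V\<close>: an infinite
    set has \<open>card\<close> 0, so \<open>card F \<le> f\<close> does not provide it.\<close>
  have "E \<subseteq> Pow V"
    using G by (auto simp: graph_def)
  then have "finite F"
    using F G by (meson finite_Pow_iff finite_subset graph_def)
  moreover have "card e = 2" if "e \<in> F" for e
    using that F G by (auto simp: graph_def)
  ultimately obtain c :: "'a \<Rightarrow> 'a" where c: "finite (range c)" "card (range c) \<le> 2 * f"
    "\<And>x y. c x = c y \<Longrightarrow> gdist V (EA - F) x y = gdist V EA x y"
    using fault_colouring[of F f V EA] F f by metis
  show "ereal_of_enat (gdist V ?H s t) \<le> ereal_of_enat (gdist V (E - F) s t) + ereal \<gamma>"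
  proof (cases "gdist V (E - F) s t")
    case (enat k)
    then obtain p where p: "walk V (E - F) p" "hd p = s" "last p = t" "length p = Suc k"
      by (rule gdist_shortest_walkE)
    have pV: "p ! i \<in> V" if "i \<le> k" for i
      using p that by (auto simp: walk_def subset_iff)
    let ?D = "\<lambda>i j. ereal_of_enat (gdist V ?H (p ! i) (p ! j))"
    have "?D 0 k \<le> ereal (real (k - 0) +
        (real (card ((\<lambda>i. c (p ! i)) ` {0..k})) - 1) * (\<beta> + \<alpha> - 1) + \<beta>)"
    proof (rule coloured_chain_bound)
      show "?D i l \<le> ?D i j + ?D j l" for i j l
        using gdist_triangle[of V ?H "p ! i" "p ! l" "p ! j"]
        by (simp add: ereal_of_enat_add[symmetric])
    next
      fix i assume i: "i < k"
      have "?D i (Suc i) \<le> ereal_of_enat (gdist V (EM - F) (p ! i) (p ! Suc i))"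
        by (simp add: gdist_antimono Diff_mono)
      also have "\<dots> \<le> ereal \<alpha> * ereal_of_enat (gdist V (E - F) (p ! i) (p ! Suc i))"
        using M F i pV by (auto simp: mult_ft_spanner_def)
      also have "\<dots> \<le> ereal \<alpha> * ereal_of_enat (enat 1)"
        using gdist_le_walk_infix[OF p(1), of i "Suc i"] i p(4) \<alpha>
        by (intro ereal_mult_left_mono) (auto simp del: ereal_of_enat_simps)
      finally show "?D i (Suc i) \<le> ereal \<alpha>"
        by simp
    next
      fix i j assume ij: "i \<le> j" "j \<le> k" "c (p ! i) = c (p ! j)"
      have "?D i j \<le> ereal_of_enat (gdist V (EA - F) (p ! i) (p ! j))"
        by (simp add: gdist_antimono Diff_mono)
      also have "\<dots> = ereal_of_enat (gdist V EA (p ! i) (p ! j))"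
        using c(3) ij by simp
      also have "\<dots> \<le> ereal_of_enat (gdist V E (p ! i) (p ! j)) + ereal \<beta>"
        using A ij pV by (auto simp: additive_spanner_def)
      \<comment> \<open>The additive spanner compares with \<open>E\<close> rather than
        \<open>E - F\<close>, but the path is a walk in \<open>E\<close> as well.\<close>
      also have "\<dots> \<le> ereal_of_enat (enat (j - i)) + ereal \<beta>"
        using gdist_le_walk_infix[OF walk_mono[OF p(1)], of E i j] ij p(4)
        by (intro add_right_mono) (auto simp del: ereal_of_enat_simps)
      finally show "?D i j \<le> ereal (real (j - i) + \<beta>)"
        by simp
    qed (use \<alpha> \<beta> in auto)
    moreover have "p ! 0 = s" "p ! k = t"
      using p by (auto simp: walk_def hd_conv_nth last_conv_nth)
    moreover have "card ((\<lambda>i. c (p ! i)) ` {0..k}) \<le> 2 * f"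
      using c(1,2) by (meson card_mono image_subsetI order_trans rangeI)
    then have "(real (card ((\<lambda>i. c (p ! i)) ` {0..k})) - 1) * (\<beta> + \<alpha> - 1)
        \<le> (2 * real f - 1) * (\<beta> + \<alpha> - 1)"
      using \<alpha> \<beta> by (intro mult_right_mono) linarith+
    ultimately have "ereal_of_enat (gdist V ?H s t) \<le> ereal (real k + \<gamma>)"
      using \<gamma>[OF \<beta>] by (auto elim!: order_trans)
    then show ?thesis
      using enat by simp
  qed simp
qed

theorem theorem1:
  fixes V :: "'a set" and E EA EM :: "'a set set"
    and \<alpha> \<beta> :: real and f :: nat
  assumes "graph V E"
    and "f \<ge> 1"
    and "\<alpha> \<ge> 1"
    and "additive_spanner V E EA \<beta>"
    and "mult_ft_spanner V E EM \<alpha> f"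
  shows "additive_ft_spanner V E (EA \<union> EM) (2 * real f * (\<beta> + \<alpha> - 1) + \<beta>) f
         \<and> (f = 1 \<longrightarrow> additive_ft_spanner V E (EA \<union> EM) (2 * \<beta> + \<alpha> - 1) 1)"
proof (intro conjI impI)
  show "additive_ft_spanner V E (EA \<union> EM) (2 * real f * (\<beta> + \<alpha> - 1) + \<beta>) f"
    \<comment> \<open>This bound allows one more \<beta> + \<alpha> - 1 than the lemma requires; for
      \<open>f = 1\<close> below the requirement is met with equality.\<close>
    using assms by (intro additive_ft_spanner_union[of V E f \<alpha> EA \<beta>]) (auto simp: left_diff_distrib)
next
  assume "f = 1"
  then show "additive_ft_spanner V E (EA \<union> EM) (2 * \<beta> + \<alpha> - 1) 1"
    using assms by (intro additive_ft_spanner_union[of V E 1 \<alpha> EA \<beta>]) auto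
qed

end
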